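(* Let $r\ge1$ be an integer, let $\mathcal{D}\subseteq\mathbb{R}^n$ be open, let $h\colon\mathcal{D}\to\mathbb{R}$ be $r$-times continuously differentiable, let $f\colon\mathcal{D}\to\mathbb{R}^n$ (locally Lipschitz) be $(r-1)$-times continuously differentiable, let $G\colon\mathcal{D}\to\mathbb{R}^{n\times m}$ be continuous, and, for $x\in\mathcal{D}$ and $j\in\{1,\ldots,m\}$, let $g\triangleq\mathrm{col}_j(G(x))\in\mathbb{R}^n$. Define the bivariate seed $$z_g\triangleq\sum_{k=0}^{r-1}\frac1{k!}\,\tilde f^{[k]}(x+g\,\epsilon_2)\,\epsilon_1^k\in\mathbb{D}_{(r-1,1)}^n,$$ where $\tilde f^{[k]}$ is the $\epsilon_2$-dual extension of the iterate $f^{[k]}$. Then $$\tilde h(z_g)=\sum_{k=0}^{r-1}\frac1{k!}\Big(L_f^kh(x)+L_gL_f^kh(x)\,\epsilon_2\Big)\epsilon_1^k.$$ In particular, $L_{\mathrm{col}_j(G)}L_f^{r-1}h(x)=(r-1)!\,b_{r-1}$, where $b_{r-1}$ is the coefficient of $\epsilon_1^{r-1}\epsilon_2$ in $\tilde h(z_g)$.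
   Context: The bivariate truncated dual ring is $\mathbb{D}_{(r-1,1)}\triangleq\mathbb{R}[\epsilon_1,\epsilon_2]/(\epsilon_1^r,\epsilon_2^2)$; each element is uniquely $z=\sum_{k=0}^{r-1}(a_k+b_k\epsilon_2)\epsilon_1^k$ with $a_k,b_k\in\mathbb{R}$. Equivalently it is the truncated polynomial ring of order $r-1$ in $\epsilon_1$ with coefficients in $\mathbb{R}[\epsilon_2]/(\epsilon_2^2)$. $\epsilon_2$-dual extension: for a continuously differentiable map $\eta$ from an open subset of $\mathbb{R}^n$ to $\mathbb{R}^k$, $\tilde\eta(x+w\epsilon_2)\triangleq\eta(x)+\eta'(x)w\,\epsilon_2$. Dual extension to $\mathbb{D}_{(r-1,1)}$: for $\phi\in C^r$ of one variable and $z=\sum_k(a_k+b_k\epsilon_2)\epsilon_1^k$ with $\epsilon_1$-constant term $z_0=a_0+b_0\epsilon_2$, $\tilde\phi(z)\triangleq\sum_{j=0}^{r-1}\frac1{j!}\widetilde{\phi^{(j)}}(z_0)\,(z-z_0)^j$, where $\widetilde{\phi^{(j)}}$ is the $\epsilon_2$-dual extension of $\phi^{(j)}$. The multivariable form, for $h\in C^r(\mathcal{D})$ and $z\in\mathbb{D}_{(r-1,1)}^n$ with $\epsilon_1$-constant term $z_0=a_0+b_0\epsilon_2$, $a_0\in\mathcal{D}$, is $\tilde h(z)=\sum_{k=0}^{r-1}\frac1{k!}\widetilde{D^kh}(z_0)[z-z_0]^k$, where $D^kh$ is the $k$-th derivative tensor, its entries are evaluated through their $\epsilon_2$-dual extensions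 at $z_0$, and $[\,\cdot\,]^k$ denotes contraction with $k$ copies. Iterates: $f^{[0]}(x)\triangleq x$, $f^{[k]}(x)\triangleq\nabla f^{[k-1]}(x)f(x)$ ($\nabla$ the Jacobian). Lie derivatives: $L_f^0h\triangleq h$, $L_f^kh\triangleq L_f(L_f^{k-1}h)$, $L_f\eta(x)\triangleq\nabla\eta(x)f(x)$, and $L_gL_f^kh(x)\triangleq\nabla(L_f^kh)(x)\,g$. $\mathrm{col}_j$ denotes the $j$-th column. *)

theory Defs
  imports "HOL-Analysis.Analysis" "HOL-Computational_Algebra.Polynomial"
begin

section \<open>Dual numbers\<close>

text \<open>The ring \<open>\<real>[\<epsilon>\<^sub>2]/(\<epsilon>\<^sub>2\<^sup>2)\<close>; \<open>Dual a b\<close> stands for \<open>a + b \<epsilon>\<^sub>2\<close>.\<close>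

datatype dualnum = Dual (re_part: real) (eps_part: real)

instantiation dualnum :: comm_ring_1
begin

definition zero_dualnum :: dualnum where "0 = Dual 0 0"
definition one_dualnum :: dualnum where "1 = Dual 1 0"
definition plus_dualnum :: "dualnum \<Rightarrow> dualnum \<Rightarrow> dualnum" where
  "z + w = Dual (re_part z + re_part w) (eps_part z + eps_part w)"
definition minus_dualnum :: "dualnum \<Rightarrow> dualnum \<Rightarrow> dualnum" where
  "z - w = Dual (re_part z - re_part w) (eps_part z - eps_part w)"
definition uminus_dualnum :: "dualnum \<Rightarrow> dualnum" where
  "- z = Dual (- re_part z) (- eps_part z)"
definition times_dualnum :: "dualnum \<Rightarrow> dualnum \<Rightarrow> dualnum" where
  "z * w = Dual (re_part z * re_part w) (re_part z * eps_part w + eps_part z * re_part w)"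

instance
  by standard
    (simp_all add: zero_dualnum_def one_dualnum_def plus_dualnum_def minus_dualnum_def
      uminus_dualnum_def times_dualnum_def algebra_simps)

end

instantiation dualnum :: real_algebra_1
begin

definition scaleR_dualnum :: "real \<Rightarrow> dualnum \<Rightarrow> dualnum" where
  "c *\<^sub>R z = Dual (c * re_part z) (c * eps_part z)"

instance
  by standard
    (simp_all add: scaleR_dualnum_def plus_dualnum_def times_dualnum_def algebra_simps)

end

lemma dualnum_eps_square: "Dual 0 1 * Dual 0 1 = 0"
  by (simp add: times_dualnum_def zero_dualnum_def)

text \<open>Vectors of dual numbers: \<open>dual_vec a b\<close> is \<open>a + b \<epsilon>\<^sub>2\<close>.\<close>

definition dual_vec :: "real ^ 'n \<Rightarrow> real ^ 'n \<Rightarrow> dualnum ^ 'n" where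
  "dual_vec a b = (\<chi> i. Dual (a $ i) (b $ i))"

definition re_vec :: "dualnum ^ 'n \<Rightarrow> real ^ 'n" where
  "re_vec z = (\<chi> i. re_part (z $ i))"

definition eps_vec :: "dualnum ^ 'n \<Rightarrow> real ^ 'n" where
  "eps_vec z = (\<chi> i. eps_part (z $ i))"


section \<open>The bivariate truncated dual ring\<close>

text \<open>
  An element of \<open>\<real>[\<epsilon>\<^sub>1,\<epsilon>\<^sub>2]/(\<epsilon>\<^sub>1\<^sup>r,\<epsilon>\<^sub>2\<^sup>2)\<close> is represented by the unique
  polynomial of degree less than \<open>r\<close> in its class modulo \<open>\<epsilon>\<^sub>1\<^sup>r\<close>, with
  coefficients in \<open>\<real>[\<epsilon>\<^sub>2]/(\<epsilon>\<^sub>2\<^sup>2)\<close>. The canonical projection is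
  \<^const>\<open>poly_cutoff\<close> \<open>r\<close>. The following facts show that it is compatible with the ring
  operations and that its kernel is the ideal generated by \<open>\<epsilon>\<^sub>1\<^sup>r\<close>. Hence a polynomial
  expression over the quotient ring may be computed over \<^typ>\<open>dualnum poly\<close> and
  projected once at the end.
\<close>

lemma poly_cutoff_add_distrib:
  "poly_cutoff r (p + q) = poly_cutoff r p + poly_cutoff r q"
  by (simp add: poly_eq_iff coeff_poly_cutoff)

lemma poly_cutoff_mult_cutoff:
  fixes p q :: "'a::comm_ring_1 poly"
  shows "poly_cutoff r (poly_cutoff r p * poly_cutoff r q) = poly_cutoff r (p * q)"
  by (auto simp: poly_eq_iff coeff_poly_cutoff coeff_mult intro!: sum.cong)

lemma poly_cutoff_eq_0_iff_dvd:
  fixes p :: "'a::comm_ring_1 poly"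
  shows "poly_cutoff r p = 0 \<longleftrightarrow> monom 1 r dvd p"
  by (auto simp: poly_eq_iff coeff_poly_cutoff monom_1_dvd_iff')

text \<open>The coefficient of \<open>\<epsilon>\<^sub>1\<^sup>k \<epsilon>\<^sub>2\<close>.\<close>

definition eps_coeff :: "dualnum poly \<Rightarrow> nat \<Rightarrow> real" where
  "eps_coeff z k = eps_part (coeff z k)"

text \<open>The \<open>\<epsilon>\<^sub>1\<close>-constant term \<open>z\<^sub>0\<close> of a vector \<open>z\<close>.\<close>

definition const_vec :: "dualnum poly ^ 'n \<Rightarrow> dualnum ^ 'n" where
  "const_vec z = (\<chi> i. coeff (z $ i) 0)"


section \<open>Smoothness and derivatives\<close>

text \<open>\<open>k\<close>-times continuous differentiability, meant for open \<open>D\<close>.\<close>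

fun Ck_on :: "nat \<Rightarrow> ('a::real_normed_vector) set \<Rightarrow> ('a \<Rightarrow> 'b::real_normed_vector) \<Rightarrow> bool" where
  "Ck_on 0 D F \<longleftrightarrow> continuous_on D F"
| "Ck_on (Suc k) D F \<longleftrightarrow>
     (\<forall>x\<in>D. F differentiable (at x)) \<and>
     (\<forall>v. Ck_on k D (\<lambda>x. frechet_derivative F (at x) v))"

text \<open>
  \<open>tensor_entry js h\<close> is the entry of the \<open>k\<close>-th derivative tensor \<open>D\<^sup>k h\<close> with multi-index
  \<open>js\<close> of length \<open>k\<close>, that is, the iterated partial derivative along these coordinates.
\<close>

fun tensor_entry :: "'n list \<Rightarrow> (real ^ 'n \<Rightarrow> real) \<Rightarrow> real ^ 'n \<Rightarrow> real" where
  "tensor_entry [] h = h"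
| "tensor_entry (j # js) h = (\<lambda>x. frechet_derivative (tensor_entry js h) (at x) (axis j 1))"

text \<open>
  Throughout, the Jacobian of \<open>F\<close> at \<open>x\<close> applied to \<open>v\<close> is
  \<open>frechet_derivative F (at x) v\<close>.
\<close>

definition lie_deriv ::
    "(real ^ 'n \<Rightarrow> real ^ 'n) \<Rightarrow> (real ^ 'n \<Rightarrow> real) \<Rightarrow> real ^ 'n \<Rightarrow> real" where
  "lie_deriv f \<eta> = (\<lambda>x. frechet_derivative \<eta> (at x) (f x))"

fun lie_iter ::
    "(real ^ 'n \<Rightarrow> real ^ 'n) \<Rightarrow> nat \<Rightarrow> (real ^ 'n \<Rightarrow> real) \<Rightarrow> real ^ 'n \<Rightarrow> real" where
  "lie_iter f 0 h = h"
| "lie_iter f (Suc k) h = lie_deriv f (lie_iter f k h)"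

fun field_iter :: "(real ^ 'n \<Rightarrow> real ^ 'n) \<Rightarrow> nat \<Rightarrow> real ^ 'n \<Rightarrow> real ^ 'n" where
  "field_iter f 0 = (\<lambda>x. x)"
| "field_iter f (Suc k) = (\<lambda>x. frechet_derivative (field_iter f k) (at x) (f x))"


section \<open>Dual extensions\<close>

text \<open>The \<open>\<epsilon>\<^sub>2\<close>-dual extension, for scalar-valued and for vector-valued maps.\<close>

definition dual_ext :: "(real ^ 'n \<Rightarrow> real) \<Rightarrow> dualnum ^ 'n \<Rightarrow> dualnum" where
  "dual_ext \<eta> z =
     Dual (\<eta> (re_vec z)) (frechet_derivative \<eta> (at (re_vec z)) (eps_vec z))"

definition dual_ext_vec :: "(real ^ 'n \<Rightarrow> real ^ 'k) \<Rightarrow> dualnum ^ 'n \<Rightarrow> dualnum ^ 'k" where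
  "dual_ext_vec \<eta> z =
     dual_vec (\<eta> (re_vec z)) (frechet_derivative \<eta> (at (re_vec z)) (eps_vec z))"

text \<open>
  \<open>tensor_contract k h z\<^sub>0 v\<close> contracts the tensor \<open>D\<^sup>k h\<close>, its entries evaluated through their
  \<open>\<epsilon>\<^sub>2\<close>-dual extensions at \<open>z\<^sub>0\<close>, with \<open>k\<close> copies of \<open>v\<close>.
\<close>

definition tensor_contract ::
    "nat \<Rightarrow> (real ^ 'n \<Rightarrow> real) \<Rightarrow> dualnum ^ 'n \<Rightarrow> dualnum poly ^ 'n \<Rightarrow> dualnum poly" where
  "tensor_contract k h z\<^sub>0 v =
     (\<Sum>js | length js = k. [:dual_ext (tensor_entry js h) z\<^sub>0:] * prod_list (map (\<lambda>j. v $ j) js))"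

definition bidual_ext ::
    "nat \<Rightarrow> (real ^ 'n \<Rightarrow> real) \<Rightarrow> dualnum poly ^ 'n \<Rightarrow> dualnum poly" where
  "bidual_ext r h z =
     poly_cutoff r
       (\<Sum>k<r. smult ((1 / fact k) *\<^sub>R 1)
          (tensor_contract k h (const_vec z) (z - (\<chi> i. [:const_vec z $ i:]))))"

definition bivariate_seed ::
    "nat \<Rightarrow> (real ^ 'n \<Rightarrow> real ^ 'n) \<Rightarrow> real ^ 'n \<Rightarrow> real ^ 'n \<Rightarrow> dualnum poly ^ 'n" where
  "bivariate_seed r f x g =
     (\<chi> i. \<Sum>k<r. monom ((1 / fact k) *\<^sub>R dual_ext_vec (field_iter f k) (dual_vec x g) $ i) k)"

end

theory Submission
  imports Defs
begin

text \<open>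
  Let \<open>p\<^sub>i = (\<Sum>1\<le>l<r. f\<^bsup>[l]\<^esup>\<^sub>i / l! \<epsilon>\<^sub>1\<^sup>l)\<close> and let \<open>\<Phi>\<close> be the Taylor sum of \<open>h\<close> with increment \<open>p\<close>, a polynomial
  in \<open>\<epsilon>\<^sub>1\<close> whose coefficients are functions of the base point. The derivative along \<open>f\<close> takes \<open>p\<^sub>i\<close>
  to \<open>\<partial>p\<^sub>i/\<partial>\<epsilon>\<^sub>1 - f\<^sub>i\<close> modulo \<open>\<epsilon>\<^sub>1\<^bsup>r-1\<^esup>\<close>, and by symmetry of the derivative tensors the terms with \<open>f\<^sub>i\<close>
  telescope, so that \<open>\<partial>\<Phi>/\<partial>\<epsilon>\<^sub>1\<close> is the derivative of \<open>\<Phi>\<close> along \<open>f\<close> modulo \<open>\<epsilon>\<^sub>1\<^bsup>r-1\<^esup>\<close>. Comparing coefficients,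
  the coefficient of \<open>\<epsilon>\<^sub>1\<^sup>m\<close> in \<open>\<Phi>\<close> is the \<open>m\<close>-th Lie derivative of \<open>h\<close> divided by \<open>m!\<close>; no flow of
  \<open>f\<close> is needed. Since \<open>\<eta> \<mapsto> \<eta>(x) + \<eta>'(x) g \<epsilon>\<^sub>2\<close> is a ring homomorphism, the bivariate
  extension is obtained by applying it to the coefficients of \<open>\<Phi>\<close>.
\<close>

subsection \<open>Symmetry of second derivatives\<close>

lemma DERIV_along_line:
  fixes F :: "'a::real_normed_vector \<Rightarrow> real"
  assumes "F differentiable (at (p + s *\<^sub>R u))"
  shows "((\<lambda>s. F (p + s *\<^sub>R u)) has_real_derivative
           frechet_derivative F (at (p + s *\<^sub>R u)) u) (at s)"
proof -
  let ?F' = "frechet_derivative F (at (p + s *\<^sub>R u))"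
  have F': "(F has_derivative ?F') (at (p + s *\<^sub>R u))"
    using assms by (simp add: frechet_derivative_works)
  have "((\<lambda>s. p + s *\<^sub>R u) has_derivative (\<lambda>s. s *\<^sub>R u)) (at s)"
    by (auto intro!: derivative_eq_intros)
  from has_derivative_compose[OF this F']
  have "((\<lambda>s. F (p + s *\<^sub>R u)) has_derivative (\<lambda>s. ?F' (s *\<^sub>R u))) (at s)" .
  moreover have "(\<lambda>s. ?F' (s *\<^sub>R u)) = (*) (?F' u)"
    using has_derivative_linear[OF F'] by (auto simp: linear_cmul mult.commute)
  ultimately show ?thesis
    by (simp add: has_field_derivative_def)
qed

text \<open>The mean value theorem is applied twice, first along \<open>u\<close> and then along
  \<open>v\<close>. The bound on \<open>t\<close> keeps the whole parallelogram spanned by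
  \<open>t *\<^sub>R u\<close> and \<open>t *\<^sub>R v\<close> inside the ball.\<close>

lemma second_difference_mean_value:
  fixes F :: "'a::real_normed_vector \<Rightarrow> real"
  assumes F: "\<And>y. y \<in> ball x e \<Longrightarrow> F differentiable (at y)"
    and F': "\<And>y. y \<in> ball x e \<Longrightarrow> (\<lambda>y. frechet_derivative F (at y) u) differentiable (at y)"
    and t: "0 < t" "t * (norm u + norm v) < e"
  obtains a b where "0 < a" "a < t" "0 < b" "b < t"
    "F (x + t *\<^sub>R u + t *\<^sub>R v) - F (x + t *\<^sub>R u) - F (x + t *\<^sub>R v) + F x =
       t * t * frechet_derivative (\<lambda>y. frechet_derivative F (at y) u) (at (x + a *\<^sub>R u + b *\<^sub>R v)) v"
proof -
  let ?A = "\<lambda>y. frechet_derivative F (at y) u"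
  have near: "x + a *\<^sub>R u + b *\<^sub>R v \<in> ball x e" if "0 \<le> a" "a \<le> t" "0 \<le> b" "b \<le> t" for a b
  proof -
    have "norm (a *\<^sub>R u + b *\<^sub>R v) \<le> a * norm u + b * norm v"
      using that by (intro order.trans[OF norm_triangle_ineq]) simp
    also have "\<dots> \<le> t * (norm u + norm v)"
      using that by (simp add: distrib_left add_mono mult_right_mono)
    finally have "norm (a *\<^sub>R u + b *\<^sub>R v) < e"
      using t by linarith
    moreover have "dist x (x + a *\<^sub>R u + b *\<^sub>R v) = norm (a *\<^sub>R u + b *\<^sub>R v)"
      by (metis add.assoc dist_add_cancel dist_0_norm add.right_neutral)
    ultimately show ?thesis
      by simp
  qed
  \<comment> \<open>The increment \<open>p t - p 0\<close> is the second difference, so one mean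
    value step in \<open>s\<close> leaves a first difference of \<open>?A\<close> along
    \<open>v\<close>.\<close>
  define p where "p s = F ((x + t *\<^sub>R v) + s *\<^sub>R u) - F (x + s *\<^sub>R u)" for s
  have "DERIV p s :> ?A ((x + t *\<^sub>R v) + s *\<^sub>R u) - ?A (x + s *\<^sub>R u)"
    if "0 \<le> s" "s \<le> t" for s
    unfolding p_def using near[of s t] near[of s 0] that t(1)
    by (intro DERIV_diff DERIV_along_line F) (simp_all add: algebra_simps)
  from MVT2[OF t(1) this] obtain a where a: "0 < a" "a < t"
    and pa: "p t - p 0 = t * (?A ((x + t *\<^sub>R v) + a *\<^sub>R u) - ?A (x + a *\<^sub>R u))"
    by auto
  have "DERIV (\<lambda>s. ?A ((x + a *\<^sub>R u) + s *\<^sub>R v)) s :>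
      frechet_derivative ?A (at ((x + a *\<^sub>R u) + s *\<^sub>R v)) v" if "0 \<le> s" "s \<le> t" for s
    using near[of a s] that a by (intro DERIV_along_line F') simp
  from MVT2[OF t(1) this] obtain b where b: "0 < b" "b < t"
    and qb: "?A ((x + a *\<^sub>R u) + t *\<^sub>R v) - ?A (x + a *\<^sub>R u) =
      t * frechet_derivative ?A (at ((x + a *\<^sub>R u) + b *\<^sub>R v)) v"
    by auto
  show ?thesis
  proof (rule that[OF a b])
    have "F (x + t *\<^sub>R u + t *\<^sub>R v) - F (x + t *\<^sub>R u) - F (x + t *\<^sub>R v) + F x = p t - p 0"
      by (simp add: p_def algebra_simps)
    then show "F (x + t *\<^sub>R u + t *\<^sub>R v) - F (x + t *\<^sub>R u) - F (x + t *\<^sub>R v) + F x =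
       t * t * frechet_derivative ?A (at (x + a *\<^sub>R u + b *\<^sub>R v)) v"
      using pa qb by (simp add: algebra_simps)
  qed
qed

text \<open>The second difference does not change when \<open>u\<close> and \<open>v\<close> are
  exchanged, yet it equals \<open>t * t\<close> times either mixed derivative at a point close to
  \<open>x\<close>. Continuity of both mixed derivatives at \<open>x\<close> then forces their
  values there to agree.\<close>

lemma second_derivative_symmetric:
  fixes F :: "'a::real_normed_vector \<Rightarrow> real"
  assumes "open D" "x \<in> D"
    and F: "\<And>y. y \<in> D \<Longrightarrow> F differentiable (at y)"
    and F': "\<And>y w. y \<in> D \<Longrightarrow> (\<lambda>y. frechet_derivative F (at y) w) differentiable (at y)"
    and F'': "\<And>w w'. continuous_on D
      (\<lambda>y. frechet_derivative (\<lambda>y. frechet_derivative F (at y) w) (at y) w')"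
  shows "frechet_derivative (\<lambda>y. frechet_derivative F (at y) u) (at x) v =
         frechet_derivative (\<lambda>y. frechet_derivative F (at y) v) (at x) u"
proof (rule ccontr)
  let ?H = "\<lambda>w w' y. frechet_derivative (\<lambda>y. frechet_derivative F (at y) w) (at y) w'"
  assume "?H u v x \<noteq> ?H v u x"
  \<comment> \<open>Half the gap: a number cannot be strictly closer than this to both
    values.\<close>
  define \<epsilon> where "\<epsilon> = \<bar>?H u v x - ?H v u x\<bar> / 2"
  have "\<epsilon> > 0"
    using \<open>?H u v x \<noteq> ?H v u x\<close> by (simp add: \<epsilon>_def)
  have "\<exists>d>0. \<forall>y. dist y x < d \<longrightarrow> dist (?H w w' y) (?H w w' x) < \<epsilon>" for w w'
  proof -
    have "isCont (?H w w') x"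
      using continuous_on_eq_continuous_at[OF \<open>open D\<close>] F''[of w w'] \<open>x \<in> D\<close> by blast
    then show ?thesis
      using \<open>\<epsilon> > 0\<close> unfolding continuous_at_eps_delta by blast
  qed
  then obtain d1 d2 where d1: "d1 > 0" "\<And>y. dist y x < d1 \<Longrightarrow> dist (?H u v y) (?H u v x) < \<epsilon>"
    and d2: "d2 > 0" "\<And>y. dist y x < d2 \<Longrightarrow> dist (?H v u y) (?H v u x) < \<epsilon>"
    by metis
  obtain e0 where e0: "e0 > 0" "ball x e0 \<subseteq> D"
    using \<open>open D\<close> \<open>x \<in> D\<close> openE by blast
  define e where "e = min e0 (min d1 d2)"
  have "e > 0" and eD: "ball x e \<subseteq> D"
    using e0 d1 d2 by (auto simp: e_def)
  \<comment> \<open>The summand 1 keeps the denominator positive even for \<open>u = v = 0\<close>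
    and makes \<open>t * (norm u + norm v) < e\<close> strict.\<close>
  define t where "t = e / (norm u + norm v + 1)"
  have N: "norm u + norm v + 1 > 0"
    using norm_ge_zero[of u] norm_ge_zero[of v] by linarith
  then have "t > 0"
    using \<open>e > 0\<close> by (simp add: t_def)
  have "t * (norm u + norm v + 1) = e"
    using N unfolding t_def by (metis less_irrefl nonzero_eq_divide_eq)
  then have te: "t * (norm u + norm v) < e" "t * (norm v + norm u) < e"
    using \<open>t > 0\<close> by (simp_all add: algebra_simps)
  have near: "dist (x + a *\<^sub>R u + b *\<^sub>R v) x < e" if "0 < a" "a < t" "0 < b" "b < t" for a b
  proof -
    have "norm (a *\<^sub>R u + b *\<^sub>R v) \<le> a * norm u + b * norm v"
      using that by (intro order.trans[OF norm_triangle_ineq]) simp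
    also have "\<dots> \<le> t * (norm u + norm v)"
      using that by (simp add: distrib_left add_mono mult_right_mono)
    finally show ?thesis
      using te(1) by (simp add: dist_norm algebra_simps)
  qed
  obtain a b where ab: "0 < a" "a < t" "0 < b" "b < t"
    "F (x + t *\<^sub>R u + t *\<^sub>R v) - F (x + t *\<^sub>R u) - F (x + t *\<^sub>R v) + F x =
       t * t * ?H u v (x + a *\<^sub>R u + b *\<^sub>R v)"
    using second_difference_mean_value[OF F F' \<open>t > 0\<close> te(1)] eD by blast
  obtain b' a' where ab': "0 < b'" "b' < t" "0 < a'" "a' < t"
    "F (x + t *\<^sub>R v + t *\<^sub>R u) - F (x + t *\<^sub>R v) - F (x + t *\<^sub>R u) + F x =
       t * t * ?H v u (x + b' *\<^sub>R v + a' *\<^sub>R u)"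
    using second_difference_mean_value[OF F F' \<open>t > 0\<close> te(2)] eD by blast
  have "t * t * ?H u v (x + a *\<^sub>R u + b *\<^sub>R v) = t * t * ?H v u (x + a' *\<^sub>R u + b' *\<^sub>R v)"
  proof -
    have "x + t *\<^sub>R v + t *\<^sub>R u = x + t *\<^sub>R u + t *\<^sub>R v"
      "x + b' *\<^sub>R v + a' *\<^sub>R u = x + a' *\<^sub>R u + b' *\<^sub>R v"
      by (simp_all add: add_ac)
    then show ?thesis
      using ab(5) ab'(5) by (metis (no_types, lifting) add.commute diff_diff_eq)
  qed
  then have "?H u v (x + a *\<^sub>R u + b *\<^sub>R v) = ?H v u (x + a' *\<^sub>R u + b' *\<^sub>R v)"
    using \<open>t > 0\<close> by simp
  moreover have "dist (?H u v (x + a *\<^sub>R u + b *\<^sub>R v)) (?H u v x) < \<epsilon>"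
    using near[OF ab(1-4)] by (intro d1) (simp add: e_def)
  moreover have "dist (?H v u (x + a' *\<^sub>R u + b' *\<^sub>R v)) (?H v u x) < \<epsilon>"
    using near[OF ab'(3,4,1,2)] by (intro d2) (simp add: e_def)
  ultimately show False
    unfolding \<epsilon>_def dist_real_def by argo
qed

subsection \<open>Continuously differentiable maps\<close>

lemma frechet_derivative_cong_open:
  assumes "open D" "x \<in> D" "\<And>y. y \<in> D \<Longrightarrow> F y = G y" "F differentiable (at x)"
  shows "frechet_derivative F (at x) = frechet_derivative G (at x)"
  using frechet_derivative_transform_within_open[OF assms(4,1,2)] assms(3) by blast

lemma differentiable_cong_open:
  assumes "open D" "x \<in> D" "\<And>y. y \<in> D \<Longrightarrow> F y = G y" "F differentiable (at x)"
  shows "G differentiable (at x)"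
  using assms has_derivative_transform_within_open unfolding differentiable_def by metis

text \<open>The rules of differentiation give \<open>frechet_derivative\<close> only at points of
  \<open>D\<close>. This congruence lets the closure proofs below replace a derivative by its
  formula; openness of \<open>D\<close> makes derivatives depend on values in \<open>D\<close>
  alone.\<close>

lemma Ck_on_cong:
  assumes "open D" "\<And>y. y \<in> D \<Longrightarrow> F y = G y" "Ck_on k D F"
  shows "Ck_on k D G"
  using assms(2,3)
proof (induction k arbitrary: F G)
  case 0
  then show ?case
    using continuous_on_cong[of D D F G] by simp
next
  case (Suc k)
  have d: "\<forall>x\<in>D. F differentiable (at x)"
    using Suc.prems by simp
  have "G differentiable (at x)" if "x \<in> D" for x
    using differentiable_cong_open[where F = F, OF \<open>open D\<close> that Suc.prems(1)] d that by blast
  moreover have "Ck_on k D (\<lambda>x. frechet_derivative G (at x) v)" for v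
  proof (rule Suc.IH)
    show "Ck_on k D (\<lambda>x. frechet_derivative F (at x) v)"
      using Suc.prems by simp
    show "frechet_derivative F (at y) v = frechet_derivative G (at y) v" if "y \<in> D" for y
      using frechet_derivative_cong_open[where F = F, OF \<open>open D\<close> that Suc.prems(1)] d that by simp
  qed
  ultimately show ?case
    by simp
qed

lemma Ck_on_SucD: "Ck_on (Suc k) D F \<Longrightarrow> Ck_on k D F"
proof (induction k arbitrary: F)
  case 0
  then show ?case
    by (auto intro!: continuous_at_imp_continuous_on differentiable_imp_continuous_within)
next
  case (Suc k)
  then show ?case
    by (metis Ck_on.simps(2))
qed

lemma Ck_on_mono: "Ck_on k D F \<Longrightarrow> l \<le> k \<Longrightarrow> Ck_on l D F"
  by (induction k) (auto simp del: Ck_on.simps simp: le_Suc_eq dest: Ck_on_SucD)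

lemma Ck_on_differentiable: "Ck_on k D F \<Longrightarrow> k > 0 \<Longrightarrow> x \<in> D \<Longrightarrow> F differentiable (at x)"
  by (cases k) auto

lemma Ck_on_const: "Ck_on k D (\<lambda>x. c)"
  by (induction k arbitrary: c) auto

lemma Ck_on_add:
  assumes "open D"
  shows "Ck_on k D F \<Longrightarrow> Ck_on k D G \<Longrightarrow> Ck_on k D (\<lambda>x. F x + G x)"
proof (induction k arbitrary: F G)
  case 0
  then show ?case
    by (simp add: continuous_on_add)
next
  case (Suc k)
  have d: "F differentiable (at x)" "G differentiable (at x)" if "x \<in> D" for x
    using Suc.prems that by auto
  have "Ck_on k D (\<lambda>x. frechet_derivative (\<lambda>x. F x + G x) (at x) v)" for v
  proof (rule Ck_on_cong[OF \<open>open D\<close>])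
    show "Ck_on k D (\<lambda>x. frechet_derivative F (at x) v + frechet_derivative G (at x) v)"
      using Suc.prems by (intro Suc.IH) auto
    show "frechet_derivative F (at x) v + frechet_derivative G (at x) v =
        frechet_derivative (\<lambda>x. F x + G x) (at x) v" if "x \<in> D" for x
      using frechet_derivative_at[OF has_derivative_add[OF d[OF that, unfolded frechet_derivative_works]]]
      by metis
  qed
  with d show ?case
    by simp
qed

lemma Ck_on_sum:
  assumes "open D" "\<And>i. i \<in> I \<Longrightarrow> Ck_on k D (F i)"
  shows "Ck_on k D (\<lambda>x. \<Sum>i\<in>I. F i x)"
  using assms(2)
  by (induction I rule: infinite_finite_induct) (auto simp: Ck_on_const Ck_on_add[OF \<open>open D\<close>])

lemma frechet_derivative_scaleR:
  fixes a :: "'a::real_normed_vector \<Rightarrow> real"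
  assumes "a differentiable (at x)" "F differentiable (at x)"
  shows "frechet_derivative (\<lambda>x. a x *\<^sub>R F x) (at x) v =
    a x *\<^sub>R frechet_derivative F (at x) v + frechet_derivative a (at x) v *\<^sub>R F x"
proof -
  have "((\<lambda>x. a x *\<^sub>R F x) has_derivative
      (\<lambda>v. a x *\<^sub>R frechet_derivative F (at x) v + frechet_derivative a (at x) v *\<^sub>R F x)) (at x)"
    using assms by (intro has_derivative_scaleR) (simp_all add: frechet_derivative_works)
  from frechet_derivative_at[OF this] show ?thesis
    by metis
qed

lemma Ck_on_scaleR:
  fixes a :: "'a::real_normed_vector \<Rightarrow> real"
  assumes "open D"
  shows "Ck_on k D a \<Longrightarrow> Ck_on k D F \<Longrightarrow> Ck_on k D (\<lambda>x. a x *\<^sub>R F x)"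
proof (induction k arbitrary: a F)
  case 0
  then show ?case
    by (simp add: continuous_on_scaleR)
next
  case (Suc k)
  have d: "a differentiable (at x)" "F differentiable (at x)" if "x \<in> D" for x
    using Suc.prems that by auto
  have "Ck_on k D (\<lambda>x. frechet_derivative (\<lambda>x. a x *\<^sub>R F x) (at x) v)" for v
  proof (rule Ck_on_cong[OF \<open>open D\<close>])
    show "Ck_on k D (\<lambda>x. a x *\<^sub>R frechet_derivative F (at x) v + frechet_derivative a (at x) v *\<^sub>R F x)"
      \<comment> \<open>The product rule pairs each derivative with an undifferentiated factor,
        whose order is lowered by one to meet the induction hypothesis.\<close>
      using Suc.prems Ck_on_SucD[OF Suc.prems(1)] Ck_on_SucD[OF Suc.prems(2)]
      by (intro Ck_on_add Suc.IH \<open>open D\<close>) auto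
    show "a x *\<^sub>R frechet_derivative F (at x) v + frechet_derivative a (at x) v *\<^sub>R F x =
        frechet_derivative (\<lambda>x. a x *\<^sub>R F x) (at x) v" if "x \<in> D" for x
      using d[OF that] by (simp add: frechet_derivative_scaleR)
  qed
  with d show ?case
    by simp
qed

lemma frechet_derivative_bounded_linear:
  assumes "bounded_linear T" "F differentiable (at x)"
  shows "frechet_derivative (\<lambda>x. T (F x)) (at x) = (\<lambda>v. T (frechet_derivative F (at x) v))"
  using frechet_derivative_at[OF bounded_linear.has_derivative[OF assms(1)
    frechet_derivative_works[THEN iffD1, OF assms(2)]]] by simp

lemma Ck_on_bounded_linear:
  assumes "open D" "bounded_linear T"
  shows "Ck_on k D F \<Longrightarrow> Ck_on k D (\<lambda>x. T (F x))"
proof (induction k arbitrary: F)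
  case 0
  then show ?case
    by (simp add: bounded_linear.continuous_on[OF assms(2)])
next
  case (Suc k)
  have d: "F differentiable (at x)" if "x \<in> D" for x
    using Suc.prems that by auto
  have "(\<lambda>x. T (F x)) differentiable (at x)" if "x \<in> D" for x
    using d[OF that] bounded_linear.has_derivative[OF assms(2)] unfolding differentiable_def by blast
  moreover have "Ck_on k D (\<lambda>x. frechet_derivative (\<lambda>x. T (F x)) (at x) v)" for v
  proof (rule Ck_on_cong[OF \<open>open D\<close>])
    show "Ck_on k D (\<lambda>x. T (frechet_derivative F (at x) v))"
      using Suc.prems by (intro Suc.IH) auto
    show "T (frechet_derivative F (at x) v) = frechet_derivative (\<lambda>x. T (F x)) (at x) v"
      if "x \<in> D" for x
      using frechet_derivative_bounded_linear[OF assms(2) d[OF that]] by simp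
  qed
  ultimately show ?case
    by simp
qed

lemma frechet_derivative_sum_axis:
  fixes F :: "real ^ 'n \<Rightarrow> 'b::real_normed_vector"
  assumes "F differentiable (at x)"
  shows "frechet_derivative F (at x) v = (\<Sum>i\<in>UNIV. v $ i *\<^sub>R frechet_derivative F (at x) (axis i 1))"
proof -
  have "linear (frechet_derivative F (at x))"
    using assms by (simp add: linear_frechet_derivative)
  then have "(\<Sum>i\<in>UNIV. v $ i *\<^sub>R frechet_derivative F (at x) (axis i 1)) =
      frechet_derivative F (at x) (\<Sum>i\<in>UNIV. v $ i *\<^sub>R axis i 1)"
    by (simp add: linear_sum linear_cmul)
  then show ?thesis
    using basis_expansion[of v] by (simp add: scalar_mult_eq_scaleR)
qed

text \<open>\<open>Ck_on\<close> speaks of derivatives in a fixed direction, whereas here the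
  direction varies with \<open>x\<close>. Expanding \<open>f x\<close> in coordinates leaves a sum
  of products of fixed-direction derivatives with components of \<open>f\<close>.\<close>

lemma Ck_on_derivative_along_field:
  fixes F :: "real ^ 'n \<Rightarrow> 'b::real_normed_vector"
  assumes "open D" "Ck_on (Suc k) D F" "Ck_on k D f"
  shows "Ck_on k D (\<lambda>x. frechet_derivative F (at x) (f x))"
proof (rule Ck_on_cong[OF \<open>open D\<close>])
  show "Ck_on k D (\<lambda>x. \<Sum>i\<in>UNIV. f x $ i *\<^sub>R frechet_derivative F (at x) (axis i 1))"
    using assms by (intro Ck_on_sum Ck_on_scaleR Ck_on_bounded_linear[OF _ bounded_linear_vec_nth]) auto
  show "(\<Sum>i\<in>UNIV. f x $ i *\<^sub>R frechet_derivative F (at x) (axis i 1)) =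
      frechet_derivative F (at x) (f x)" if "x \<in> D" for x
    using assms that by (intro frechet_derivative_sum_axis[symmetric]) auto
qed

section \<open>Regularity of the iterates and of the derivative tensors\<close>

lemma field_iter_Suc_0: "field_iter f (Suc 0) = f"
  by (simp add: frechet_derivative_id)

text \<open>The first iterate is \<open>f\<close>, of class \<open>r - 1\<close>, and each further
  one costs one derivative. Iterates of index below \<open>r\<close> therefore stay
  differentiable.\<close>

lemma Ck_on_field_iter:
  assumes "open D" "Ck_on (r - 1) D f"
  shows "k < r \<Longrightarrow> Ck_on (r - Suc k) D (field_iter f (Suc k))"
proof (induction k)
  case 0
  then show ?case
    using assms by (simp only: field_iter_Suc_0) simp
next
  case (Suc k)
  have "Suc (r - Suc (Suc k)) = r - Suc k"
    using Suc.prems by simp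
  then show ?case
    unfolding field_iter.simps(2)[of f "Suc k"]
    using Suc Ck_on_mono[OF assms(2), of "r - Suc (Suc k)"]
    by (intro Ck_on_derivative_along_field[OF \<open>open D\<close>]) auto
qed

lemma field_iter_differentiable:
  assumes "open D" "Ck_on (r - 1) D f" "k < r" "x \<in> D"
  shows "field_iter f k differentiable (at x)"
proof (cases k)
  case (Suc l)
  then show ?thesis
    using Ck_on_differentiable[OF Ck_on_field_iter[OF assms(1,2), of l]] assms by simp
qed simp

lemma Ck_on_tensor_entry:
  "Ck_on (k + length js) D h \<Longrightarrow> Ck_on k D (tensor_entry js h)"
proof (induction js arbitrary: k)
  case (Cons j js)
  have "Ck_on (Suc k) D (tensor_entry js h)"
    using Cons.IH[of "Suc k"] Cons.prems by (simp del: Ck_on.simps)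
  then show ?case
    by simp
qed simp

lemma tensor_entry_differentiable:
  assumes "Ck_on r D h" "length js < r" "x \<in> D"
  shows "tensor_entry js h differentiable (at x)"
  using Ck_on_differentiable[OF Ck_on_tensor_entry[of "r - length js" js D h]] assms by simp

text \<open>The head of the list is the outermost derivative. The exchange thus happens on the twice
  continuously differentiable function \<open>tensor_entry js h\<close>, and the derivatives in
  \<open>is\<close> preserve an equality valid on all of \<open>D\<close>, hence the induction over
  arbitrary \<open>x\<close>.\<close>

lemma tensor_entry_swap:
  assumes "open D" "Ck_on r D h" "length (is @ i # j # js) \<le> r" "x \<in> D"
  shows "tensor_entry (is @ i # j # js) h x = tensor_entry (is @ j # i # js) h x"
  using assms(3,4)
proof (induction "is" arbitrary: x)
  case Nil
  have "Ck_on 2 D (tensor_entry js h)"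
    using Nil Ck_on_mono[OF assms(2), of "2 + length js"] by (intro Ck_on_tensor_entry) simp
  then have "Ck_on (Suc (Suc 0)) D (tensor_entry js h)"
    by (simp only: numeral_2_eq_2)
  then show ?case
    using second_derivative_symmetric[OF \<open>open D\<close> Nil(2), of "tensor_entry js h"] by simp
next
  case (Cons a "is")
  have "tensor_entry (is @ i # j # js) h differentiable (at x)"
    using Cons.prems by (intro tensor_entry_differentiable[OF assms(2)]) auto
  then have "frechet_derivative (tensor_entry (is @ i # j # js) h) (at x) =
      frechet_derivative (tensor_entry (is @ j # i # js) h) (at x)"
    using Cons by (intro frechet_derivative_cong_open[OF \<open>open D\<close>, of x]) auto
  then show ?case
    by simp
qed

subsection \<open>Symmetric contractions\<close>

text \<open>The first-order variation of the product of the \<open>p j\<close> when each factor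
  varies by \<open>w j\<close>. It describes both \<open>pderiv\<close> and the
  \<open>\<epsilon>\<^sub>2\<close>-part of such a product, which makes the two comparable.\<close>

fun leibniz :: "('n \<Rightarrow> 'a::comm_ring_1) \<Rightarrow> ('n \<Rightarrow> 'a) \<Rightarrow> 'n list \<Rightarrow> 'a" where
  "leibniz p w [] = 0"
| "leibniz p w (j # js) = w j * prod_list (map p js) + p j * leibniz p w js"

lemma leibniz_diff: "leibniz p w js - leibniz p w' js = leibniz p (\<lambda>i. w i - w' i) js"
proof (induction js)
  case (Cons j js)
  then show ?case
    by (simp add: algebra_simps flip: Cons.IH)
qed simp

lemma pderiv_prod_list: "pderiv (prod_list (map p js)) = leibniz p (\<lambda>i. pderiv (p i)) js"
  by (induction js) (simp_all add: pderiv_mult)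

lemma sum_lists_Suc:
  fixes F :: "'n::finite list \<Rightarrow> 'b::comm_monoid_add"
  shows "(\<Sum>js | length js = Suc k. F js) = (\<Sum>i\<in>UNIV. \<Sum>js | length js = k. F (i # js))"
proof -
  have fin: "finite {js :: 'n list. length js = k}"
    using finite_lists_length_eq[of "UNIV :: 'n set" k] by simp
  have "(\<Sum>i\<in>UNIV. \<Sum>js | length js = k. F (i # js)) =
      (\<Sum>(i, js)\<in>UNIV \<times> {js. length js = k}. F (i # js))"
    using fin by (subst sum.cartesian_product) simp
  also have "\<dots> = (\<Sum>js | length js = Suc k. F js)"
    by (rule sum.reindex_bij_witness[of _ "\<lambda>js. (hd js, tl js)" "\<lambda>(i, js). i # js"])
      (auto simp: length_Suc_conv)
  finally show ?thesis ..
qed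

text \<open>By symmetry of \<open>A\<close> the position holding \<open>w\<close> can be moved to
  the front, so all \<open>Suc k\<close> positions contribute equally.\<close>

lemma symmetric_contraction_leibniz:
  fixes A :: "'n::finite list \<Rightarrow> 'a::comm_ring_1"
  assumes "\<And>is i j js. length (is @ i # j # js) = Suc k \<Longrightarrow> A (is @ i # j # js) = A (is @ j # i # js)"
  shows "(\<Sum>js | length js = Suc k. A js * leibniz p w js) =
    of_nat (Suc k) * (\<Sum>i\<in>UNIV. w i * (\<Sum>js | length js = k. A (i # js) * prod_list (map p js)))"
  using assms
proof (induction k arbitrary: A)
  case 0
  then show ?case
    by (simp add: sum_lists_Suc mult.commute)
next
  case (Suc k)
  let ?P = "\<lambda>js. prod_list (map p js)"
  let ?W = "\<Sum>i\<in>UNIV. w i * (\<Sum>js | length js = Suc k. A (i # js) * ?P js)"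
  have IH: "(\<Sum>js | length js = Suc k. A (i # js) * leibniz p w js) =
      of_nat (Suc k) * (\<Sum>j\<in>UNIV. w j * (\<Sum>js | length js = k. A (i # j # js) * ?P js))" for i
    by (rule Suc.IH) (use Suc.prems[of "i # _"] in auto)
  have swap: "A (i # j # js) = A (j # i # js)" if "length js = k" for i j js
    using Suc.prems[of "[]" i j js] that by simp
  have "(\<Sum>js | length js = Suc (Suc k). A js * leibniz p w js) =
      ?W + (\<Sum>i\<in>UNIV. p i * (\<Sum>js | length js = Suc k. A (i # js) * leibniz p w js))"
    unfolding sum_lists_Suc[of _ "Suc k"]
    by (simp add: distrib_left sum.distrib sum_distrib_left mult_ac)
  also have "(\<Sum>i\<in>UNIV. p i * (\<Sum>js | length js = Suc k. A (i # js) * leibniz p w js)) =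
      of_nat (Suc k) *
        (\<Sum>i\<in>UNIV. \<Sum>j\<in>UNIV. w j * (p i * (\<Sum>js | length js = k. A (i # j # js) * ?P js)))"
    unfolding IH by (simp only: sum_distrib_left mult_ac)
  \<comment> \<open>Exchanging the sums and then the two leading indices brings the index carrying
    \<open>w\<close> to the front, which yields \<open>?W\<close> again.\<close>
  also have "(\<Sum>i\<in>UNIV. \<Sum>j\<in>UNIV. w j * (p i * (\<Sum>js | length js = k. A (i # j # js) * ?P js))) =
      (\<Sum>j\<in>UNIV. \<Sum>i\<in>UNIV. w j * (p i * (\<Sum>js | length js = k. A (j # i # js) * ?P js)))"
    by (subst sum.swap) (simp add: swap)
  also have "\<dots> = ?W"
    unfolding sum_lists_Suc by (simp add: sum_distrib_left mult_ac)
  finally show ?case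
    by (simp add: algebra_simps)
qed

text \<open>Each factor lacks a constant term and contributes one power of the variable. This
  disposes of the contraction of highest order, the one left over by the telescoping.\<close>

lemma monom_dvd_prod_list:
  assumes "\<And>i. monom 1 1 dvd p i"
  shows "monom (1::'a::comm_ring_1) (length js) dvd prod_list (map p js)"
proof (induction js)
  case (Cons j js)
  have "monom (1::'a) (length (j # js)) = monom 1 1 * monom 1 (length js)"
    by (simp add: mult_monom)
  then show ?case
    using mult_dvd_mono[OF assms Cons.IH, of j] by simp
qed (simp add: monom_0 flip: one_pCons)

text \<open>
  Moving one factor out of the Leibniz sum turns the contraction of order \<open>k + 1\<close> into
  \<open>k + 1\<close> times a contraction of order \<open>k\<close>, so all contributions of \<open>v\<close> telescope.
\<close>

lemma taylor_sum_transport: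
  fixes A A' :: "'n::finite list \<Rightarrow> real" and p w :: "'n \<Rightarrow> real poly" and v :: "'n \<Rightarrow> real"
  assumes sym: "\<And>is i j js. length (is @ i # j # js) \<le> s \<Longrightarrow>
      A (is @ i # j # js) = A (is @ j # i # js)"
    and A': "\<And>js. length js \<le> s \<Longrightarrow> A' js = (\<Sum>i\<in>UNIV. v i * A (i # js))"
    and p: "\<And>i. monom 1 1 dvd p i"
    and w: "\<And>i. monom 1 s dvd w i - pderiv (p i) + [:v i:]"
  shows "monom 1 s dvd
    (\<Sum>k<Suc s. smult (1 / fact k) (\<Sum>js | length js = k.
        [:A' js:] * prod_list (map p js) + [:A js:] * leibniz p w js))
    - pderiv (\<Sum>k<Suc s. smult (1 / fact k) (\<Sum>js | length js = k.
        [:A js:] * prod_list (map p js)))"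
proof -
  let ?P = "\<lambda>js. prod_list (map p js)" and ?E = "monom (1::real) s"
  \<comment> \<open>The discrepancy between \<open>w\<close> and the derivative of \<open>p\<close>;
    by assumption \<open>w\<close> it is \<open>- v i\<close> modulo \<open>?E\<close>.\<close>
  define u where "u i = w i - pderiv (p i)" for i
  define S where "S i k = (\<Sum>js | length js = k. [:A (i # js):] * ?P js)" for i k
  define T where "T k = (\<Sum>i\<in>UNIV. [:v i:] * S i k)" for k
  define C where "C k = (\<Sum>js | length js = k. [:A js:] * leibniz p u js)" for k
  have T: "(\<Sum>js | length js = k. [:A' js:] * ?P js) = T k" if "k \<le> s" for k
  proof -
    have "(\<Sum>js | length js = k. [:A' js:] * ?P js) =
        (\<Sum>js | length js = k. \<Sum>i\<in>UNIV. [:v i:] * ([:A (i # js):] * ?P js))"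
      using that by (intro sum.cong) (auto simp: A' smult_sum mult.commute)
    also have "\<dots> = T k"
      unfolding T_def S_def by (subst sum.swap) (simp only: sum_distrib_left)
    finally show ?thesis .
  qed
  have pderiv_sum: "pderiv (\<Sum>i\<in>I. F i) = (\<Sum>i\<in>I. pderiv (F i))" for F :: "'c \<Rightarrow> real poly" and I
    using higher_pderiv_sum[of 1 F I] by simp
  have pderiv_const_mult: "pderiv ([:c:] * q) = [:c:] * pderiv q" for c and q :: "real poly"
    by (simp add: pderiv_smult)
  \<comment> \<open>\<open>leibniz\<close> is linear in its second argument, so the terms with
    \<open>w\<close> and those from \<open>pderiv\<close> combine into \<open>C k\<close>.\<close>
  have "(\<Sum>k<Suc s. smult (1 / fact k) (\<Sum>js | length js = k. [:A' js:] * ?P js + [:A js:] * leibniz p w js))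
      - pderiv (\<Sum>k<Suc s. smult (1 / fact k) (\<Sum>js | length js = k. [:A js:] * ?P js)) =
      (\<Sum>k<Suc s. smult (1 / fact k) ((\<Sum>js | length js = k. [:A' js:] * ?P js) + C k))"
    unfolding C_def u_def leibniz_diff[symmetric]
      pderiv_sum pderiv_smult pderiv_const_mult pderiv_prod_list
      sum_subtractf[symmetric] smult_diff_right[symmetric] sum.distrib[symmetric]
    by (intro sum.cong refl arg_cong2[of _ _ _ _ smult]) (simp only: algebra_simps)
  also have "\<dots> = (\<Sum>k<Suc s. smult (1 / fact k) (T k + C k))"
    by (intro sum.cong refl) (simp only: T lessThan_iff less_Suc_eq_le)
  finally have eq: "(\<Sum>k<Suc s. smult (1 / fact k) (\<Sum>js | length js = k.
        [:A' js:] * ?P js + [:A js:] * leibniz p w js))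
      - pderiv (\<Sum>k<Suc s. smult (1 / fact k) (\<Sum>js | length js = k. [:A js:] * ?P js)) =
      (\<Sum>k<Suc s. smult (1 / fact k) (T k + C k))" .
  have "C 0 = 0"
    by (simp add: C_def)
  \<comment> \<open>Symmetry extracts \<open>u i\<close> from the Leibniz sum, and replacing it by
    \<open>- v i\<close> turns \<open>C (Suc k)\<close> into \<open>- (Suc k)\<close> times
    \<open>T k\<close> modulo \<open>?E\<close>.\<close>
  have C_Suc: "?E dvd C (Suc k) + smult (of_nat (Suc k)) (T k)" if "Suc k \<le> s" for k
  proof -
    have "C (Suc k) = of_nat (Suc k) * (\<Sum>i\<in>UNIV. u i * S i k)"
      unfolding C_def S_def using that sym
      by (intro symmetric_contraction_leibniz) simp
    moreover have "smult (of_nat (Suc k)) (T k) = of_nat (Suc k) * T k"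
      by (simp add: of_nat_poly del: of_nat_Suc)
    ultimately have "C (Suc k) + smult (of_nat (Suc k)) (T k) =
        of_nat (Suc k) * ((\<Sum>i\<in>UNIV. u i * S i k) + T k)"
      by (metis distrib_left)
    also have "(\<Sum>i\<in>UNIV. u i * S i k) + T k = (\<Sum>i\<in>UNIV. (u i + [:v i:]) * S i k)"
      by (simp only: T_def distrib_right sum.distrib)
    finally have "C (Suc k) + smult (of_nat (Suc k)) (T k) =
        of_nat (Suc k) * (\<Sum>i\<in>UNIV. (u i + [:v i:]) * S i k)" .
    moreover have "?E dvd (\<Sum>i\<in>UNIV. (u i + [:v i:]) * S i k)"
      using w by (intro dvd_sum dvd_mult2) (simp add: u_def)
    ultimately show ?thesis
      by (simp only: dvd_mult)
  qed
  \<comment> \<open>After division by factorials, \<open>C (Suc k)\<close> cancels the preceding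
    \<open>T k\<close>, so each partial sum reduces to its last \<open>T\<close>.\<close>
  have "?E dvd (\<Sum>k<Suc l. smult (1 / fact k) (T k + C k)) - smult (1 / fact l) (T l)"
    if "l \<le> s" for l
    using that
  proof (induction l)
    case 0
    then show ?case
      by (simp add: \<open>C 0 = 0\<close>)
  next
    case (Suc l)
    let ?R = "\<Sum>k<Suc l. smult (1 / fact k) (T k + C k)"
    have "(1 / fact (Suc l)) * of_nat (Suc l) = (1 / fact l :: real)"
      by (simp add: field_simps del: of_nat_Suc)
    then have "(\<Sum>k<Suc (Suc l). smult (1 / fact k) (T k + C k)) - smult (1 / fact (Suc l)) (T (Suc l)) =
        (?R - smult (1 / fact l) (T l)) +
        smult (1 / fact (Suc l)) (C (Suc l) + smult (of_nat (Suc l)) (T l))"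
      by (simp only: sum.lessThan_Suc[of _ "Suc l"] smult_add_right smult_smult)
    then show ?case
      using Suc C_Suc[of l] by (simp only: dvd_add dvd_smult Suc_leD)
  qed
  then have "?E dvd (\<Sum>k<Suc s. smult (1 / fact k) (T k + C k)) - smult (1 / fact s) (T s)"
    by simp
  \<comment> \<open>The surviving term contains products of \<open>s\<close> factors without
    constant term.\<close>
  moreover have "?E dvd smult (1 / fact s) (T s)"
    unfolding T_def S_def
  proof (intro dvd_smult dvd_sum dvd_mult)
    fix js :: "'n list"
    assume "js \<in> {js. length js = s}"
    then show "?E dvd ?P js"
      using monom_dvd_prod_list[OF p, of js] by simp
  qed
  ultimately have "?E dvd (\<Sum>k<Suc s. smult (1 / fact k) (T k + C k))"
    by (metis diff_add_cancel dvd_add)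
  then show ?thesis
    unfolding eq .
qed

subsection \<open>Polynomials over the dual numbers\<close>

lemma re_part_simps [simp]:
  "re_part 0 = 0" "re_part 1 = 1" "re_part (z + w) = re_part z + re_part w"
  "re_part (z - w) = re_part z - re_part w"
  "re_part (z * w) = re_part z * re_part w" "re_part (c *\<^sub>R z) = c * re_part z"
  by (simp_all add: zero_dualnum_def one_dualnum_def plus_dualnum_def minus_dualnum_def
      times_dualnum_def scaleR_dualnum_def)

lemma eps_part_simps [simp]:
  "eps_part 0 = 0" "eps_part 1 = 0" "eps_part (z + w) = eps_part z + eps_part w"
  "eps_part (z - w) = eps_part z - eps_part w"
  "eps_part (z * w) = re_part z * eps_part w + eps_part z * re_part w"
  "eps_part (c *\<^sub>R z) = c * eps_part z"
  by (simp_all add: zero_dualnum_def one_dualnum_def plus_dualnum_def minus_dualnum_def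
      times_dualnum_def scaleR_dualnum_def)

lemma re_part_sum: "re_part (\<Sum>i\<in>I. F i) = (\<Sum>i\<in>I. re_part (F i))"
  by (induction I rule: infinite_finite_induct) simp_all

lemma eps_part_sum: "eps_part (\<Sum>i\<in>I. F i) = (\<Sum>i\<in>I. eps_part (F i))"
  by (induction I rule: infinite_finite_induct) simp_all

definition re_poly :: "dualnum poly \<Rightarrow> real poly" where
  "re_poly = map_poly re_part"

definition eps_poly :: "dualnum poly \<Rightarrow> real poly" where
  "eps_poly = map_poly eps_part"

lemma coeff_re_poly [simp]: "coeff (re_poly Z) m = re_part (coeff Z m)"
  by (simp add: re_poly_def coeff_map_poly)

lemma coeff_eps_poly [simp]: "coeff (eps_poly Z) m = eps_part (coeff Z m)"
  by (simp add: eps_poly_def coeff_map_poly)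

lemma re_poly_const: "re_poly [:z:] = [:re_part z:]"
  by (simp add: poly_eq_iff coeff_pCons split: nat.split)

lemma eps_poly_const: "eps_poly [:z:] = [:eps_part z:]"
  by (simp add: poly_eq_iff coeff_pCons split: nat.split)

lemma eps_poly_sum: "eps_poly (\<Sum>i\<in>I. F i) = (\<Sum>i\<in>I. eps_poly (F i))"
  by (simp add: poly_eq_iff coeff_sum eps_part_sum)

lemma re_poly_mult: "re_poly (Z * W) = re_poly Z * re_poly W"
  by (simp add: poly_eq_iff coeff_mult re_part_sum)

lemma eps_poly_mult: "eps_poly (Z * W) = re_poly Z * eps_poly W + eps_poly Z * re_poly W"
  by (simp add: poly_eq_iff coeff_mult eps_part_sum sum.distrib)

lemma eps_poly_smult: "eps_poly (smult (c *\<^sub>R 1) Z) = smult c (eps_poly Z)"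
  by (simp add: poly_eq_iff)

lemma re_poly_prod_list: "re_poly (prod_list (map q js)) = prod_list (map (\<lambda>j. re_poly (q j)) js)"
  by (induction js) (simp_all add: re_poly_mult one_pCons re_poly_const)

text \<open>\<open>eps_poly\<close> is a derivation over the ring homomorphism
  \<open>re_poly\<close>, hence obeys the recursion of \<open>leibniz\<close>.\<close>

lemma eps_poly_prod_list:
  "eps_poly (prod_list (map q js)) = leibniz (\<lambda>j. re_poly (q j)) (\<lambda>j. eps_poly (q j)) js"
  by (induction js)
    (simp_all add: eps_poly_mult re_poly_prod_list one_pCons eps_poly_const algebra_simps)

text \<open>
  The coefficients of \<open>Z\<close> are the \<open>\<epsilon>\<^sub>2\<close>-dual extensions at \<open>x + v \<epsilon>\<^sub>2\<close> of the coefficients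
  of the family \<open>P\<close>.
\<close>

definition dual_lift ::
    "(real ^ 'n \<Rightarrow> real poly) \<Rightarrow> real ^ 'n \<Rightarrow> real ^ 'n \<Rightarrow> dualnum poly \<Rightarrow> bool" where
  "dual_lift P x v Z \<longleftrightarrow> (\<forall>m. (\<lambda>y. coeff (P y) m) differentiable (at x) \<and>
     coeff Z m = Dual (coeff (P x) m) (frechet_derivative (\<lambda>y. coeff (P y) m) (at x) v))"

text \<open>Uniqueness of the derivative admits any witness, so derivative rules can be used
  directly.\<close>

lemma dual_liftI:
  assumes "\<And>m. \<exists>F'. ((\<lambda>y. coeff (P y) m) has_derivative F') (at x) \<and>
    coeff Z m = Dual (coeff (P x) m) (F' v)"
  shows "dual_lift P x v Z"
  using assms unfolding dual_lift_def differentiable_def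
  by (metis frechet_derivative_at)

lemma dual_liftD:
  assumes "dual_lift P x v Z"
  shows "((\<lambda>y. coeff (P y) m) has_derivative frechet_derivative (\<lambda>y. coeff (P y) m) (at x)) (at x)"
    and "coeff Z m = Dual (coeff (P x) m) (frechet_derivative (\<lambda>y. coeff (P y) m) (at x) v)"
  using assms unfolding dual_lift_def by (auto simp: frechet_derivative_works)

lemma dual_lift_re_poly: "dual_lift P x v Z \<Longrightarrow> re_poly Z = P x"
  by (simp add: poly_eq_iff dual_lift_def)

lemma dual_lift_const:
  assumes "\<eta> differentiable (at x)"
  shows "dual_lift (\<lambda>y. [:\<eta> y:]) x v [:Dual (\<eta> x) (frechet_derivative \<eta> (at x) v):]"
proof (rule dual_liftI)
  fix m
  show "\<exists>F'. ((\<lambda>y. coeff [:\<eta> y:] m) has_derivative F') (at x) \<and>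
    coeff [:Dual (\<eta> x) (frechet_derivative \<eta> (at x) v):] m = Dual (coeff [:\<eta> x:] m) (F' v)"
  proof (cases m)
    case 0
    then show ?thesis
      using assms by (auto simp: frechet_derivative_works)
  next
    case (Suc l)
    have "((\<lambda>y. 0 :: real) has_derivative (\<lambda>_. 0)) (at x)"
      by simp
    then show ?thesis
      using Suc by (intro exI[of _ "\<lambda>_. 0"]) (simp add: zero_dualnum_def)
  qed
qed

lemma dual_lift_one: "dual_lift (\<lambda>y. 1) x v 1"
  using dual_lift_const[of "\<lambda>_. 1" x v] by (simp add: one_pCons one_dualnum_def)

lemma dual_lift_sum:
  assumes "\<And>i. i \<in> I \<Longrightarrow> dual_lift (P i) x v (Z i)"
  shows "dual_lift (\<lambda>y. \<Sum>i\<in>I. P i y) x v (\<Sum>i\<in>I. Z i)"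
proof (rule dual_liftI)
  fix m
  let ?F' = "\<lambda>w. \<Sum>i\<in>I. frechet_derivative (\<lambda>y. coeff (P i y) m) (at x) w"
  have "((\<lambda>y. coeff (\<Sum>i\<in>I. P i y) m) has_derivative ?F') (at x)"
    unfolding coeff_sum by (intro has_derivative_sum dual_liftD(1)[OF assms])
  moreover have "coeff (\<Sum>i\<in>I. Z i) m = Dual (coeff (\<Sum>i\<in>I. P i x) m) (?F' v)"
    by (rule dualnum.expand)
      (simp add: coeff_sum re_part_sum eps_part_sum dual_liftD(2)[OF assms])
  ultimately show "\<exists>F'. ((\<lambda>y. coeff (\<Sum>i\<in>I. P i y) m) has_derivative F') (at x) \<and>
      coeff (\<Sum>i\<in>I. Z i) m = Dual (coeff (\<Sum>i\<in>I. P i x) m) (F' v)"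
    by blast
qed

text \<open>Coefficients of a product are finite convolutions; the product rule on each term is
  exactly multiplication of dual numbers.\<close>

lemma dual_lift_mult:
  assumes P: "dual_lift P x v Z" and Q: "dual_lift Q x v W"
  shows "dual_lift (\<lambda>y. P y * Q y) x v (Z * W)"
proof (rule dual_liftI)
  fix m
  let ?F' = "\<lambda>w. \<Sum>i\<le>m. coeff (P x) i * frechet_derivative (\<lambda>y. coeff (Q y) (m - i)) (at x) w +
      frechet_derivative (\<lambda>y. coeff (P y) i) (at x) w * coeff (Q x) (m - i)"
  have "((\<lambda>y. coeff (P y * Q y) m) has_derivative ?F') (at x)"
    unfolding coeff_mult
    by (intro has_derivative_sum has_derivative_mult dual_liftD(1)[OF P] dual_liftD(1)[OF Q])
  moreover have "coeff (Z * W) m = Dual (coeff (P x * Q x) m) (?F' v)"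
    by (rule dualnum.expand)
      (simp add: coeff_mult re_part_sum eps_part_sum dual_liftD(2)[OF P] dual_liftD(2)[OF Q])
  ultimately show "\<exists>F'. ((\<lambda>y. coeff (P y * Q y) m) has_derivative F') (at x) \<and>
      coeff (Z * W) m = Dual (coeff (P x * Q x) m) (F' v)"
    by blast
qed

lemma dual_lift_smult:
  assumes "dual_lift P x v Z"
  shows "dual_lift (\<lambda>y. smult c (P y)) x v (smult (c *\<^sub>R 1) Z)"
proof -
  have "dual_lift (\<lambda>y. [:c:]) x v [:c *\<^sub>R 1:]"
    using dual_lift_const[of "\<lambda>_. c" x v] by (simp add: one_dualnum_def scaleR_dualnum_def)
  from dual_lift_mult[OF this assms] show ?thesis
    by simp
qed

lemma dual_lift_prod_list:
  assumes "\<And>j. dual_lift (\<lambda>y. p y j) x v (q j)"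
  shows "dual_lift (\<lambda>y. prod_list (map (p y) js)) x v (prod_list (map q js))"
  by (induction js) (simp_all add: dual_lift_one dual_lift_mult assms)

subsection \<open>The seed and the Taylor polynomial\<close>

text \<open>The real part of the seed increment as a function of the base point \<open>y\<close>.
  The sum starts at 1 because subtracting the \<open>\<epsilon>\<^sub>1\<close>-constant term
  removes index 0.\<close>

definition seed_poly :: "nat \<Rightarrow> (real ^ 'n \<Rightarrow> real ^ 'n) \<Rightarrow> real ^ 'n \<Rightarrow> 'n \<Rightarrow> real poly" where
  "seed_poly r f y i = (\<Sum>l = 1..<r. monom (field_iter f l y $ i / fact l) l)"

text \<open>The polynomial \<Phi> of the introduction, kept without truncation; its coefficients
  below \<open>r\<close> are the ones compared with Lie derivatives.\<close>

definition taylor_poly ::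
    "nat \<Rightarrow> (real ^ 'n \<Rightarrow> real) \<Rightarrow> (real ^ 'n \<Rightarrow> real ^ 'n) \<Rightarrow> real ^ 'n \<Rightarrow> real poly" where
  "taylor_poly r h f y = (\<Sum>k<r. smult (1 / fact k) (\<Sum>js | length js = k.
     [:tensor_entry js h y:] * prod_list (map (seed_poly r f y) js)))"

abbreviation seed_increment ::
    "nat \<Rightarrow> (real ^ 'n \<Rightarrow> real ^ 'n) \<Rightarrow> real ^ 'n \<Rightarrow> real ^ 'n \<Rightarrow> dualnum poly ^ 'n" where
  "seed_increment r f x g \<equiv>
     bivariate_seed r f x g - (\<chi> i. [:const_vec (bivariate_seed r f x g) $ i:])"

lemma coeff_seed_poly:
  "coeff (seed_poly r f y i) m = (if 1 \<le> m \<and> m < r then field_iter f m y $ i / fact m else 0)"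
  by (auto simp: seed_poly_def coeff_sum)

lemma re_vec_dual_vec [simp]: "re_vec (dual_vec a b) = a"
  by (simp add: re_vec_def dual_vec_def vec_eq_iff)

lemma eps_vec_dual_vec [simp]: "eps_vec (dual_vec a b) = b"
  by (simp add: eps_vec_def dual_vec_def vec_eq_iff)

lemma dual_vec_nth [simp]: "dual_vec a b $ i = Dual (a $ i) (b $ i)"
  by (simp add: dual_vec_def)

lemma coeff_bivariate_seed:
  "coeff (bivariate_seed r f x g $ i) m = (if m < r then (1 / fact m) *\<^sub>R
     Dual (field_iter f m x $ i) (frechet_derivative (field_iter f m) (at x) g $ i) else 0)"
  by (auto simp: bivariate_seed_def coeff_sum dual_ext_vec_def)

lemma const_vec_bivariate_seed:
  "1 \<le> r \<Longrightarrow> const_vec (bivariate_seed r f x g) = dual_vec x g"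
  by (simp add: const_vec_def coeff_bivariate_seed vec_eq_iff
      scaleR_dualnum_def)

lemma coeff_seed_increment:
  "coeff (seed_increment r f x g $ i) m = (if 1 \<le> m \<and> m < r then (1 / fact m) *\<^sub>R
     Dual (field_iter f m x $ i) (frechet_derivative (field_iter f m) (at x) g $ i) else 0)"
  by (cases m) (auto simp: const_vec_def coeff_bivariate_seed)

lemma dual_lift_seed:
  assumes "\<And>l. l < r \<Longrightarrow> field_iter f l differentiable (at x)"
  shows "dual_lift (\<lambda>y. seed_poly r f y i) x g (seed_increment r f x g $ i)"
proof (rule dual_liftI)
  fix m
  show "\<exists>F'. ((\<lambda>y. coeff (seed_poly r f y i) m) has_derivative F') (at x) \<and>
      coeff (seed_increment r f x g $ i) m = Dual (coeff (seed_poly r f x i) m) (F' g)"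
  proof (cases "1 \<le> m \<and> m < r")
    case True
    let ?F' = "\<lambda>w. frechet_derivative (field_iter f m) (at x) w $ i / fact m"
    have "(field_iter f m has_derivative frechet_derivative (field_iter f m) (at x)) (at x)"
      using assms True by (simp add: frechet_derivative_works)
    from bounded_linear.has_derivative[OF bounded_linear_vec_nth this, of i]
    have "((\<lambda>y. field_iter f m y $ i / fact m) has_derivative ?F') (at x)"
      by (rule bounded_linear.has_derivative[OF bounded_linear_divide])
    then show ?thesis
      using True by (intro exI[of _ ?F']) (simp add: coeff_seed_poly coeff_seed_increment scaleR_dualnum_def
        del: vector_minus_component)
  next
    case False
    have "((\<lambda>y. 0 :: real) has_derivative (\<lambda>_. 0)) (at x)"
      by simp
    then show ?thesis
      unfolding coeff_seed_poly coeff_seed_increment using False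
      by (intro exI[of _ "\<lambda>_. 0"]) (auto simp: zero_dualnum_def)
  qed
qed

text \<open>The lifted polynomial is the bivariate extension before truncation. Both sides are built
  alike from tensor entries and seed components by sums, products and scalings, all of which respect
  lifts.\<close>

lemma dual_lift_taylor_poly:
  assumes "1 \<le> r"
    and f: "\<And>l. l < r \<Longrightarrow> field_iter f l differentiable (at x)"
    and h: "\<And>js. length js < r \<Longrightarrow> tensor_entry js h differentiable (at x)"
  shows "dual_lift (taylor_poly r h f) x g
    (\<Sum>k<r. smult ((1 / fact k) *\<^sub>R 1)
       (tensor_contract k h (dual_vec x g) (seed_increment r f x g)))"
  unfolding taylor_poly_def tensor_contract_def dual_ext_def re_vec_dual_vec eps_vec_dual_vec
  by (intro dual_lift_sum dual_lift_smult dual_lift_mult dual_lift_prod_list dual_lift_const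
      dual_lift_seed f h) simp_all

lemma coeff_bidual_ext:
  assumes "1 \<le> r" "m < r"
    and f: "\<And>l. l < r \<Longrightarrow> field_iter f l differentiable (at x)"
    and h: "\<And>js. length js < r \<Longrightarrow> tensor_entry js h differentiable (at x)"
  shows "coeff (bidual_ext r h (bivariate_seed r f x g)) m =
    Dual (coeff (taylor_poly r h f x) m)
      (frechet_derivative (\<lambda>y. coeff (taylor_poly r h f y) m) (at x) g)"
  using dual_liftD(2)[OF dual_lift_taylor_poly[OF assms(1) f h]] assms(2)
  by (simp add: bidual_ext_def coeff_poly_cutoff const_vec_bivariate_seed[OF assms(1)])

section \<open>Lie derivatives as Taylor coefficients\<close>

lemma pderiv_taylor_poly:
  assumes sym: "\<And>is i j js. length (is @ i # j # js) \<le> s \<Longrightarrow>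
      tensor_entry (is @ i # j # js) h x = tensor_entry (is @ j # i # js) h x"
    and f: "\<And>l. l < Suc s \<Longrightarrow> field_iter f l differentiable (at x)"
    and h: "\<And>js. length js < Suc s \<Longrightarrow> tensor_entry js h differentiable (at x)"
    and "m < s"
  shows "frechet_derivative (\<lambda>y. coeff (taylor_poly (Suc s) h f y) m) (at x) (f x) =
    coeff (pderiv (taylor_poly (Suc s) h f x)) m"
proof -
  \<comment> \<open>The direction of the lift is taken to be \<open>f x\<close>, so the
    \<open>\<epsilon>\<^sub>2\<close>-part of \<open>?Z\<close> is the derivative of the Taylor
    polynomial along \<open>f\<close> and can be computed algebraically.\<close>
  let ?q = "\<lambda>i. seed_increment (Suc s) f x (f x) $ i"
  let ?Z = "\<Sum>k<Suc s. smult ((1 / fact k) *\<^sub>R 1)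
       (tensor_contract k h (dual_vec x (f x)) (seed_increment (Suc s) f x (f x)))"
  let ?A' = "\<lambda>js. frechet_derivative (tensor_entry js h) (at x) (f x)"
  have lift: "dual_lift (taylor_poly (Suc s) h f) x (f x) ?Z"
    by (rule dual_lift_taylor_poly) (use f h in simp_all)
  have q: "re_poly (?q i) = seed_poly (Suc s) f x i" for i
    by (rule dual_lift_re_poly[OF dual_lift_seed[OF f]])
  have "eps_poly ?Z = (\<Sum>k<Suc s. smult (1 / fact k) (\<Sum>js | length js = k.
      [:?A' js:] * prod_list (map (seed_poly (Suc s) f x) js) +
      [:tensor_entry js h x:] * leibniz (seed_poly (Suc s) f x) (\<lambda>i. eps_poly (?q i)) js))"
    unfolding tensor_contract_def dual_ext_def re_vec_dual_vec eps_vec_dual_vec eps_poly_sum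
      eps_poly_smult eps_poly_mult re_poly_const eps_poly_const re_poly_prod_list
      eps_poly_prod_list q dualnum.sel
    by (simp only: add.commute)
  moreover have "monom 1 s dvd (\<Sum>k<Suc s. smult (1 / fact k) (\<Sum>js | length js = k.
      [:?A' js:] * prod_list (map (seed_poly (Suc s) f x) js) +
      [:tensor_entry js h x:] * leibniz (seed_poly (Suc s) f x) (\<lambda>i. eps_poly (?q i)) js))
      - pderiv (taylor_poly (Suc s) h f x)"
    unfolding taylor_poly_def
  proof (rule taylor_sum_transport)
    show "?A' js = (\<Sum>i\<in>UNIV. f x $ i * tensor_entry (i # js) h x)" if "length js \<le> s" for js
      using that by (subst frechet_derivative_sum_axis[OF h]) simp_all
    show "monom 1 1 dvd seed_poly (Suc s) f x i" for i
      unfolding monom_1_dvd_iff' by (simp add: coeff_seed_poly)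
    show "monom 1 s dvd eps_poly (?q i) - pderiv (seed_poly (Suc s) f x i) + [:f x $ i:]" for i
      unfolding monom_1_dvd_iff'
    proof (intro allI impI)
      fix l assume "l < s"
      have "coeff (pderiv (seed_poly (Suc s) f x i)) l =
          of_nat (Suc l) * (field_iter f (Suc l) x $ i / fact (Suc l))"
        using \<open>l < s\<close> by (simp add: coeff_pderiv coeff_seed_poly)
      also have "\<dots> = field_iter f (Suc l) x $ i / fact l"
        by (simp only: fact_Suc) (simp del: of_nat_Suc field_iter.simps)
      finally have pd: "coeff (pderiv (seed_poly (Suc s) f x i)) l = field_iter f (Suc l) x $ i / fact l" .
      show "coeff (eps_poly (?q i) - pderiv (seed_poly (Suc s) f x i) + [:f x $ i:]) l = 0"
      \<comment> \<open>At \<open>l = 0\<close> the increment has no constant coefficient, and the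
        term \<open>f x $ i\<close> left by \<open>pderiv\<close> is cancelled by
        \<open>[:f x $ i:]\<close>. For \<open>l > 0\<close> the derivative of the
        \<open>l\<close>-th iterate along \<open>f\<close> is the next iterate by
        definition.\<close>
      proof (cases l)
        case 0
        then show ?thesis
          unfolding coeff_add coeff_diff coeff_eps_poly coeff_seed_increment pd by simp
      next
        case (Suc l')
        then show ?thesis
          unfolding coeff_add coeff_diff coeff_eps_poly coeff_seed_increment pd
          using \<open>l < s\<close> by simp
      qed
    qed
  qed (rule sym)
  ultimately have "coeff (eps_poly ?Z) m = coeff (pderiv (taylor_poly (Suc s) h f x)) m"
    using \<open>m < s\<close> by (simp only: monom_1_dvd_iff' coeff_diff right_minus_eq)
  then show ?thesis
    by (simp only: coeff_eps_poly dual_liftD(2)[OF lift] dualnum.sel)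
qed

text \<open>A product of one or more seed polynomials has no constant term, so only the summand
  \<open>k = 0\<close> contributes.\<close>

lemma coeff_taylor_poly_0:
  assumes "1 \<le> r"
  shows "coeff (taylor_poly r h f y) 0 = h y"
proof -
  have z: "coeff (prod_list (map (seed_poly r f y) js)) 0 = 0" if "js \<noteq> []" for js
    using that by (cases js) (simp_all add: coeff_mult coeff_seed_poly)
  obtain s where r: "r = Suc s"
    using assms by (cases r) auto
  have "(\<Sum>k<s. coeff (smult (1 / fact (Suc k)) (\<Sum>js | length js = Suc k.
      [:tensor_entry js h y:] * prod_list (map (seed_poly r f y) js))) 0) = 0"
  proof (rule sum.neutral, intro ballI)
    fix k
    have "coeff (prod_list (map (seed_poly r f y) js)) 0 = 0" if "length js = Suc k" for js
      using that by (intro z) auto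
    then show "coeff (smult (1 / fact (Suc k)) (\<Sum>js | length js = Suc k.
      [:tensor_entry js h y:] * prod_list (map (seed_poly r f y) js))) 0 = 0"
      by (simp add: coeff_sum)
  qed
  then show ?thesis
    unfolding taylor_poly_def coeff_sum unfolding r sum.lessThan_Suc_shift by simp
qed

lemma coeff_taylor_poly_differentiable:
  assumes "open D" "Ck_on r D h" "Ck_on (r - 1) D f" "x \<in> D"
  shows "(\<lambda>y. coeff (taylor_poly r h f y) m) differentiable (at x)"
proof (cases r)
  case 0
  then show ?thesis
    by (simp add: taylor_poly_def)
next
  case (Suc s)
  then have "1 \<le> r"
    by simp
  from dual_lift_taylor_poly[OF this field_iter_differentiable[OF assms(1,3) _ assms(4)]
      tensor_entry_differentiable[OF assms(2) _ assms(4)]]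
  show ?thesis
    by (simp add: dual_lift_def)
qed

text \<open>Differentiating the coefficient of index \<open>m\<close> along \<open>f\<close> gives
  \<open>m + 1\<close> times the next one, which is the recursion of the Lie derivatives up to
  factorials.\<close>

lemma coeff_taylor_poly:
  assumes "open D" "Ck_on r D h" "Ck_on (r - 1) D f"
  shows "m < r \<Longrightarrow> x \<in> D \<Longrightarrow> coeff (taylor_poly r h f x) m = lie_iter f m h x / fact m"
proof (induction m arbitrary: x)
  case 0
  then show ?case
    by (simp add: coeff_taylor_poly_0)
next
  case (Suc m)
  then obtain s where s: "r = Suc s" "m < s"
    by (cases r) auto
  note f = field_iter_differentiable[OF assms(1,3) _ Suc.prems(2)]
  note h = tensor_entry_differentiable[OF assms(2) _ Suc.prems(2)]
  have "(\<lambda>y. coeff (taylor_poly r h f y) m) differentiable (at x)"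
    by (rule coeff_taylor_poly_differentiable[OF assms Suc.prems(2)])
  then have d: "(\<lambda>y. fact m * coeff (taylor_poly r h f y) m) differentiable (at x)"
    "frechet_derivative (\<lambda>y. fact m * coeff (taylor_poly r h f y) m) (at x) (f x) =
      fact m * frechet_derivative (\<lambda>y. coeff (taylor_poly r h f y) m) (at x) (f x)"
    by (simp_all add: frechet_derivative_bounded_linear[OF bounded_linear_mult_right])
  have "lie_iter f (Suc m) h x = frechet_derivative (lie_iter f m h) (at x) (f x)"
    by (simp add: lie_deriv_def)
  \<comment> \<open>The induction hypothesis holds throughout \<open>D\<close>, so the Lie
    derivative inherits its derivative from the coefficient, known to be differentiable.\<close>
  also have "frechet_derivative (lie_iter f m h) (at x) =
      frechet_derivative (\<lambda>y. fact m * coeff (taylor_poly r h f y) m) (at x)"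
    using Suc.IH Suc.prems
    by (intro frechet_derivative_cong_open[OF assms(1) Suc.prems(2) _ d(1), symmetric]) simp
  also have "\<dots> (f x) = fact m * coeff (pderiv (taylor_poly r h f x)) m"
    unfolding d(2)
    using pderiv_taylor_poly[OF tensor_entry_swap[OF assms(1,2) _ Suc.prems(2)] f h s(2)] s(1)
    by simp
  also have "\<dots> = fact (Suc m) * coeff (taylor_poly r h f x) (Suc m)"
    by (simp add: coeff_pderiv algebra_simps)
  finally show ?case
    by simp
qed

theorem proposition2:
  fixes r :: nat
    and D :: "(real ^ 'n) set"
    and h :: "real ^ 'n \<Rightarrow> real"
    and f :: "real ^ 'n \<Rightarrow> real ^ 'n"
    and G :: "real ^ 'n \<Rightarrow> real ^ 'm ^ 'n"
    and x g :: "real ^ 'n"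
    and j :: 'm
  assumes "r \<ge> 1"
    and "open D"
    and "Ck_on r D h"
    and "local_lipschitz (UNIV :: real set) D (\<lambda>_. f)"
    and "Ck_on (r - 1) D f"
    and "continuous_on D G"
    and "x \<in> D"
    and "g = column j (G x)"
  shows "bidual_ext r h (bivariate_seed r f x g) =
           (\<Sum>k<r. monom ((1 / fact k) *\<^sub>R
              Dual (lie_iter f k h x) (lie_deriv (\<lambda>_. g) (lie_iter f k h) x)) k)
         \<and> lie_deriv (\<lambda>y. column j (G y)) (lie_iter f (r - 1) h) x =
           fact (r - 1) * eps_coeff (bidual_ext r h (bivariate_seed r f x g)) (r - 1)"
proof -
  note f = field_iter_differentiable[OF \<open>open D\<close> \<open>Ck_on (r - 1) D f\<close> _ \<open>x \<in> D\<close>]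
  note h = tensor_entry_differentiable[OF \<open>Ck_on r D h\<close> _ \<open>x \<in> D\<close>]
  note Lie = coeff_taylor_poly[OF \<open>open D\<close> \<open>Ck_on r D h\<close> \<open>Ck_on (r - 1) D f\<close>]
  have coeff: "coeff (bidual_ext r h (bivariate_seed r f x g)) m =
      (1 / fact m) *\<^sub>R Dual (lie_iter f m h x) (lie_deriv (\<lambda>_. g) (lie_iter f m h) x)"
    if "m < r" for m
  proof -
    have "(\<lambda>y. coeff (taylor_poly r h f y) m) differentiable (at x)"
      by (rule coeff_taylor_poly_differentiable[OF \<open>open D\<close> \<open>Ck_on r D h\<close> \<open>Ck_on (r - 1) D f\<close> \<open>x \<in> D\<close>])
    then have d: "(\<lambda>y. fact m * coeff (taylor_poly r h f y) m) differentiable (at x)"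
      "frechet_derivative (\<lambda>y. fact m * coeff (taylor_poly r h f y) m) (at x) g =
        fact m * frechet_derivative (\<lambda>y. coeff (taylor_poly r h f y) m) (at x) g"
      by (simp_all add: frechet_derivative_bounded_linear[OF bounded_linear_mult_right])
    \<comment> \<open>Equality on all of \<open>D\<close> carries over to derivatives; evaluated at
      \<open>g\<close> this supplies the \<open>\<epsilon>\<^sub>2\<close>-part.\<close>
    have "frechet_derivative (\<lambda>y. fact m * coeff (taylor_poly r h f y) m) (at x) =
        frechet_derivative (lie_iter f m h) (at x)"
      using Lie[OF that]
      by (intro frechet_derivative_cong_open[OF \<open>open D\<close> \<open>x \<in> D\<close> _ d(1)]) simp
    then show ?thesis
      using coeff_bidual_ext[OF \<open>r \<ge> 1\<close> that f h] Lie[OF that \<open>x \<in> D\<close>] d(2)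
      by (simp add: lie_deriv_def scaleR_dualnum_def)
  qed
  have "bidual_ext r h (bivariate_seed r f x g) =
      (\<Sum>k<r. monom ((1 / fact k) *\<^sub>R
        Dual (lie_iter f k h x) (lie_deriv (\<lambda>_. g) (lie_iter f k h) x)) k)"
    (is "?B = ?S")
  proof (rule poly_eqI)
    fix m
    show "coeff ?B m = coeff ?S m"
    proof (cases "m < r")
      case True
      then show ?thesis
        by (simp add: coeff coeff_sum)
    next
      case False
      then show ?thesis
        by (simp add: bidual_ext_def coeff_poly_cutoff coeff_sum)
    qed
  qed
  \<comment> \<open>\<open>lie_deriv\<close> evaluates its field only at \<open>x\<close>, so the
    column of \<open>G\<close> may be replaced by the constant field \<open>g\<close>.\<close>
  moreover have "lie_deriv (\<lambda>y. column j (G y)) (lie_iter f (r - 1) h) x =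
      fact (r - 1) * eps_coeff ?B (r - 1)"
    using coeff[of "r - 1"] \<open>r \<ge> 1\<close> \<open>g = column j (G x)\<close>
    by (simp add: eps_coeff_def lie_deriv_def)
  ultimately show ?thesis
    by blast
qed

end
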